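(* Let $W$ be a Coxeter group with set $S$ of simple reflections. For $w\in W$, we have $\mathrm{dp}(w)=\ell_T(w)$ if and only if $\ell_S(w)=\ell_T(w)$.
   Context: $T=\{wsw^{-1}: w\in W, s\in S\}$ is the set of all reflections of $W$. $\ell_S(w)$ (length) and $\ell_T(w)$ (reflection length) are the minimal numbers of factors in an expression of $w$ as a product of elements of $S$, respectively of $T$. Let $\Phi=\Pi\cup(-\Pi)$ be the root system associated to $(W,S)$, with $\Pi$ the positive roots; each positive root $\beta$ corresponds to a reflection $t_\beta\in T$ with $t_\beta(\beta)=-\beta$, and $\beta\mapsto t_\beta$ is a bijection $\Pi\to T$. The depth of a positive root is $\mathrm{dp}(\beta)=\min\{k : s_1\cdots s_k(\beta)\in -\Pi \text{ for some } s_1,\dots,s_k\in S\}$. The depth of $w\in W$ is $$\mathrm{dp}(w)=\min\Big\{\sum_{i=1}^k \mathrm{dp}(\beta_i) : k\ge 0,\ w=t_{\beta_1}\cdots t_{\beta_k},\ \beta_i\in\Pi\Big\},$$ with the identity being the empty product. *)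

theory Defs
  imports Complex_Main "HOL-Algebra.Generated_Groups" "HOL-Library.Poly_Mapping"
begin

section \<open>Coxeter systems\<close>

text \<open>A Coxeter matrix takes values in \<open>{1, 2, 3, \<dots>} \<union> {\<infinity>}\<close>; the entry \<open>\<infinity>\<close> is encoded as \<open>0\<close>
  (the same convention as \<open>group.ord\<close> for elements of infinite order).\<close>

definition coxeter_matrix :: "'a set \<Rightarrow> ('a \<Rightarrow> 'a \<Rightarrow> nat) \<Rightarrow> bool" where
  "coxeter_matrix S m \<longleftrightarrow>
     (\<forall>s\<in>S. \<forall>t\<in>S. m s t = m t s \<and> (m s t = 1 \<longleftrightarrow> s = t))"

inductive coxeter_step :: "'a set \<Rightarrow> ('a \<Rightarrow> 'a \<Rightarrow> nat) \<Rightarrow> 'a list \<Rightarrow> 'a list \<Rightarrow> bool"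
  for S :: "'a set" and m :: "'a \<Rightarrow> 'a \<Rightarrow> nat" where
  "\<lbrakk>us \<in> lists S; vs \<in> lists S; s \<in> S; t \<in> S; m s t \<noteq> 0\<rbrakk> \<Longrightarrow>
     coxeter_step S m (us @ vs) (us @ concat (replicate (m s t) [s, t]) @ vs)"

text \<open>The assumptions \<open>generates\<close> and \<open>presentation\<close> say that the group is presented by
  generators \<open>S\<close> and relations \<open>(s t)\<^bsup>m s t\<^esup> = 1\<close> for \<open>m s t\<close> finite. Words need no formal
  inverses: the case \<open>s = t\<close> yields the relation \<open>s s = 1\<close>, so the monoid with this
  presentation is already the group with this presentation.\<close>

locale coxeter_system = group W
  for W :: "('a, 'b) monoid_scheme" (structure) +
  fixes S :: "'a set" and m :: "'a \<Rightarrow> 'a \<Rightarrow> nat"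
  assumes simple_in_carrier: "S \<subseteq> carrier W"
    and matrix: "coxeter_matrix S m"
    and generates: "generate W S = carrier W"
    and presentation: "\<lbrakk>us \<in> lists S; vs \<in> lists S\<rbrakk> \<Longrightarrow>
          foldr (\<otimes>) us \<one> = foldr (\<otimes>) vs \<one> \<longleftrightarrow> equivclp (coxeter_step S m) us vs"
begin

definition word_prod :: "'a list \<Rightarrow> 'a" where
  "word_prod ws = foldr (\<otimes>) ws \<one>"

definition reflections :: "'a set" where
  "reflections = {w \<otimes> s \<otimes> inv w | w s. w \<in> carrier W \<and> s \<in> S}"

definition simple_length :: "'a \<Rightarrow> nat" where
  "simple_length w = (LEAST k. \<exists>ws \<in> lists S. length ws = k \<and> w = word_prod ws)"

definition reflection_length :: "'a \<Rightarrow> nat" where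
  "reflection_length w = (LEAST k. \<exists>ts \<in> lists reflections. length ts = k \<and> w = word_prod ts)"


subsection \<open>The root system\<close>

text \<open>Geometric representation on the real vector space with basis \<open>(\<alpha>\<^sub>s)\<close>; its vectors are
  finitely supported functions, and \<open>bform\<close> is the standard symmetric bilinear form with
  \<open>B(\<alpha>\<^sub>s, \<alpha>\<^sub>t) = -cos (\<pi> / m s t)\<close>, read as \<open>-1\<close> when \<open>m s t = \<infinity>\<close>.\<close>

definition simple_root :: "'a \<Rightarrow> 'a \<Rightarrow>\<^sub>0 real" where
  "simple_root s = Poly_Mapping.single s 1"

definition form_coeff :: "'a \<Rightarrow> 'a \<Rightarrow> real" where
  "form_coeff s t = (if m s t = 0 then - 1 else - cos (pi / real (m s t)))"

definition bform :: "('a \<Rightarrow>\<^sub>0 real) \<Rightarrow> ('a \<Rightarrow>\<^sub>0 real) \<Rightarrow> real" where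
  "bform u v = (\<Sum>s \<in> Poly_Mapping.keys u. \<Sum>t \<in> Poly_Mapping.keys v.
     Poly_Mapping.lookup u s * Poly_Mapping.lookup v t * form_coeff s t)"

definition simple_act :: "'a \<Rightarrow> ('a \<Rightarrow>\<^sub>0 real) \<Rightarrow> ('a \<Rightarrow>\<^sub>0 real)" where
  "simple_act s v = v - Poly_Mapping.single s (2 * bform (simple_root s) v)"

text \<open>The action of a group element is computed from any word in \<open>S\<close> representing it. The
  choice is immaterial because the maps \<open>simple_act s\<close> satisfy the defining relations.\<close>

definition act :: "'a \<Rightarrow> ('a \<Rightarrow>\<^sub>0 real) \<Rightarrow> ('a \<Rightarrow>\<^sub>0 real)" where
  "act w v = foldr simple_act (SOME ws. ws \<in> lists S \<and> w = word_prod ws) v"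

definition roots :: "('a \<Rightarrow>\<^sub>0 real) set" where
  "roots = {act w (simple_root s) | w s. w \<in> carrier W \<and> s \<in> S}"

definition positive_roots :: "('a \<Rightarrow>\<^sub>0 real) set" where
  "positive_roots = {\<beta> \<in> roots. \<forall>s. 0 \<le> Poly_Mapping.lookup \<beta> s}"

definition root_reflection :: "('a \<Rightarrow>\<^sub>0 real) \<Rightarrow> 'a" where
  "root_reflection \<beta> = (THE t. t \<in> reflections \<and> act t \<beta> = - \<beta>)"


subsection \<open>Depth\<close>

definition root_depth :: "('a \<Rightarrow>\<^sub>0 real) \<Rightarrow> nat" where
  "root_depth \<beta> =
     (LEAST k. \<exists>ss \<in> lists S. length ss = k \<and> act (word_prod ss) \<beta> \<in> uminus ` positive_roots)"

definition depth :: "'a \<Rightarrow> nat" where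
  "depth w =
     (LEAST d. \<exists>\<beta>s \<in> lists positive_roots.
        w = word_prod (map root_reflection \<beta>s) \<and> d = (\<Sum>\<beta>\<leftarrow>\<beta>s. root_depth \<beta>))"

end

end

theory Submission
  imports Defs
begin

text \<open>Every positive root has depth at least \<open>1\<close>, and a reduced word in \<open>S\<close> is a product of
  reflections in roots of depth \<open>1\<close>, so \<open>\<ell>\<^sub>T(w) \<le> dp(w) \<le> \<ell>\<^sub>S(w)\<close>. If \<open>dp(w) = \<ell>\<^sub>T(w)\<close>,
  all roots in a factorization of minimal depth have depth \<open>1\<close>; such roots are simple, so the
  factorization is a word in \<open>S\<close> of length \<open>\<ell>\<^sub>T(w)\<close>. That a root determines its reflection
  requires the geometric representation to be faithful; this follows from Tits' theorem that
  \<open>w\<close> maps \<open>\<alpha>\<^sub>s\<close> to a nonnegative vector unless \<open>s\<close> is a right descent of \<open>w\<close>.\<close>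

section \<open>Linear algebra on finitely supported functions\<close>

definition smul :: "real \<Rightarrow> ('a \<Rightarrow>\<^sub>0 real) \<Rightarrow> ('a \<Rightarrow>\<^sub>0 real)" where
  "smul c v = Poly_Mapping.map ((*) c) v"

lemma lookup_smul [simp]: "Poly_Mapping.lookup (smul c v) s = c * Poly_Mapping.lookup v s"
  by (simp add: smul_def Poly_Mapping.map.rep_eq when_def)

lemma keys_smul_subset: "Poly_Mapping.keys (smul c v) \<subseteq> Poly_Mapping.keys v"
  by (auto simp: in_keys_iff)

lemma smul_single: "smul c (Poly_Mapping.single s a) = Poly_Mapping.single s (c * a)"
  by (rule poly_mapping_eqI) (simp add: lookup_single when_def)

lemma smul_smul: "smul a (smul b v) = smul (a * b) v"
  by (rule poly_mapping_eqI) simp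

lemma smul_uminus: "smul (- c) v = - smul c v"
  by (rule poly_mapping_eqI) simp

lemma smul_one [simp]: "smul 1 v = v"
  by (rule poly_mapping_eqI) simp

definition nonneg :: "('a \<Rightarrow>\<^sub>0 real) \<Rightarrow> bool" where
  "nonneg v \<longleftrightarrow> (\<forall>s. 0 \<le> Poly_Mapping.lookup v s)"

section \<open>Chebyshev polynomials and alternating words\<close>

text \<open>\<open>cheb c k\<close> is the Chebyshev polynomial of the second kind of degree k - 1;
  with this shift it equals sin(kx) / sin x at c = cos x.\<close>

fun cheb :: "real \<Rightarrow> nat \<Rightarrow> real" where
  "cheb c 0 = 0"
| "cheb c (Suc 0) = 1"
| "cheb c (Suc (Suc k)) = 2 * c * cheb c (Suc k) - cheb c k"

lemma cheb_cos: "cheb (cos x) k * sin x = sin (real k * x)"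
proof (induction "cos x" k rule: cheb.induct)
  case (3 k)
  have "sin (real (Suc (Suc k)) * x) + sin (real k * x) = 2 * cos x * sin (real (Suc k) * x)"
    using sin_add[of "real (Suc k) * x" x] sin_diff[of "real (Suc k) * x" x]
    by (simp add: algebra_simps)
  then show ?case using 3 by (simp add: algebra_simps)
qed auto

lemma cheb_one: "cheb 1 k = real k"
  by (induction "1::real" k rule: cheb.induct) auto

text \<open>The bound k \<le> n keeps k pi / n in [0, pi], where the sine is nonnegative, and n
  \<ge> 2 makes the factor sin(pi / n) positive. These values will be coefficients of roots.\<close>

lemma cheb_cos_pi_nonneg:
  assumes "2 \<le> n" "k \<le> n"
  shows "0 \<le> cheb (cos (pi / real n)) k"
proof -
  have s: "0 < sin (pi / real n)"
    using assms by (intro sin_gt_zero) (auto simp: field_simps)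
  have "0 \<le> sin (real k * (pi / real n))"
    using assms by (intro sin_ge_zero) (auto simp: field_simps)
  then show ?thesis
    using cheb_cos[of "pi / real n" k] s by (metis zero_le_mult_iff not_less)
qed

text \<open>These are the two coefficients that a simple root has after 2n alternating reflections:
  the root returns to itself.\<close>

lemma cheb_cos_pi_period:
  assumes "2 \<le> n"
  shows "cheb (cos (pi / real n)) (2 * n) = 0" "cheb (cos (pi / real n)) (Suc (2 * n)) = 1"
proof -
  have s: "0 < sin (pi / real n)"
    using assms by (intro sin_gt_zero) (auto simp: field_simps)
  have "real (2 * n) * (pi / real n) = 2 * pi"
    using assms by simp
  then show "cheb (cos (pi / real n)) (2 * n) = 0"
    using cheb_cos[of "pi / real n" "2 * n"] s by simp
  have "real (Suc (2 * n)) * (pi / real n) = pi / real n + 2 * pi"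
    using assms by (simp add: field_simps)
  then have "sin (real (Suc (2 * n)) * (pi / real n)) = sin (pi / real n)"
    by (metis sin_periodic)
  then show "cheb (cos (pi / real n)) (Suc (2 * n)) = 1"
    using cheb_cos[of "pi / real n" "Suc (2 * n)"] s by simp
qed

text \<open>Letters are added on the left, so that the last letter is always \<open>t\<close>.\<close>

fun alt :: "nat \<Rightarrow> 'a \<Rightarrow> 'a \<Rightarrow> 'a list" where
  "alt 0 s t = []"
| "alt (Suc k) s t = (if even k then t else s) # alt k s t"

lemma length_alt [simp]: "length (alt k s t) = k"
  by (induction k) auto

lemma alt_in_lists: "s \<in> S \<Longrightarrow> t \<in> S \<Longrightarrow> alt k s t \<in> lists S"
  by (induction k) auto

lemma alt_snoc: "alt k s t @ [s] = alt (Suc k) t s"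
  by (induction k) auto

lemma alt_add: "\<exists>p. length p = j \<and> alt (j + k) s t = p @ alt k s t"
proof (induction j)
  case (Suc j)
  then obtain p where "length p = j" "alt (j + k) s t = p @ alt k s t" by blast
  then show ?case
    by (intro exI[of _ "(if even (j + k) then t else s) # p"]) simp
qed simp

lemma alt_double: "alt (2 * k) s t = concat (replicate k [s, t])"
  by (induction k) auto

section \<open>The geometric representation\<close>

context coxeter_system
begin

subsection \<open>Words\<close>

lemma word_prod_simps [simp]:
  "word_prod [] = \<one>" "word_prod (s # ws) = s \<otimes> word_prod ws"
  by (simp_all add: word_prod_def)

lemma simple_closed: "s \<in> S \<Longrightarrow> s \<in> carrier W"
  using simple_in_carrier by blast

lemma word_prod_closed [simp]: "set ws \<subseteq> carrier W \<Longrightarrow> word_prod ws \<in> carrier W"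
  by (induction ws) auto

lemma word_prod_closed_simple [simp]: "ws \<in> lists S \<Longrightarrow> word_prod ws \<in> carrier W"
  using simple_in_carrier by (intro word_prod_closed) auto

lemma word_prod_append:
  "set us \<subseteq> carrier W \<Longrightarrow> set vs \<subseteq> carrier W \<Longrightarrow> word_prod (us @ vs) = word_prod us \<otimes> word_prod vs"
  by (induction us) (auto simp: m_assoc)

lemma word_prod_append_simple:
  "us \<in> lists S \<Longrightarrow> vs \<in> lists S \<Longrightarrow> word_prod (us @ vs) = word_prod us \<otimes> word_prod vs"
  using simple_in_carrier by (intro word_prod_append) auto

lemma m_diag: "s \<in> S \<Longrightarrow> m s s = 1"
  using matrix by (auto simp: coxeter_matrix_def)

lemma m_sym: "s \<in> S \<Longrightarrow> t \<in> S \<Longrightarrow> m s t = m t s"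
  using matrix by (auto simp: coxeter_matrix_def)

lemma m_ge_2: "s \<in> S \<Longrightarrow> t \<in> S \<Longrightarrow> s \<noteq> t \<Longrightarrow> m s t \<noteq> 0 \<Longrightarrow> 2 \<le> m s t"
  using matrix unfolding coxeter_matrix_def
  by (metis One_nat_def Suc_leI less_one linorder_neqE_nat numeral_2_eq_2 not_less_eq_eq le_antisym not_less)

lemma word_prod_relation:
  assumes "s \<in> S" "t \<in> S" "m s t \<noteq> 0"
  shows "word_prod (concat (replicate (m s t) [s, t])) = \<one>"
proof -
  have "coxeter_step S m ([] @ []) ([] @ concat (replicate (m s t) [s, t]) @ [])"
    using assms by (intro coxeter_step.intros) auto
  then have "equivclp (coxeter_step S m) [] (concat (replicate (m s t) [s, t]))"
    by auto
  moreover have "concat (replicate (m s t) [s, t]) \<in> lists S"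
    using assms by (auto simp: in_lists_conv_set)
  ultimately show ?thesis
    using presentation[of "[]" "concat (replicate (m s t) [s, t])"]
    by (simp add: word_prod_def)
qed

lemma simple_square: "s \<in> S \<Longrightarrow> s \<otimes> s = \<one>"
  using word_prod_relation[of s s] by (simp add: m_diag simple_closed)

lemma inv_simple: "s \<in> S \<Longrightarrow> inv s = s"
  by (simp add: inv_equality simple_closed simple_square)

lemma inv_word_prod: "ws \<in> lists S \<Longrightarrow> inv (word_prod ws) = word_prod (rev ws)"
proof (induction ws)
  case (Cons s ws)
  then have "s \<in> S" "rev ws \<in> lists S" "[s] \<in> lists S" by auto
  then show ?case
    using Cons word_prod_append_simple[of "rev ws" "[s]"]
    by (simp add: inv_mult_group simple_closed inv_simple)
qed simp

lemma ex_word: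
  assumes "w \<in> carrier W"
  shows "\<exists>ws \<in> lists S. w = word_prod ws"
proof -
  have "w \<in> generate W S" using assms generates by simp
  then show ?thesis
  proof (induction rule: generate.induct)
    case one
    show ?case by (rule bexI[of _ "[]"]) auto
  next
    case (incl h)
    then show ?case by (intro bexI[of _ "[h]"]) (auto simp: simple_closed)
  next
    case (inv h)
    then show ?case by (intro bexI[of _ "[h]"]) (auto simp: simple_closed inv_simple)
  next
    case (eng h1 h2)
    then obtain us vs where "us \<in> lists S" "h1 = word_prod us" "vs \<in> lists S" "h2 = word_prod vs"
      by blast
    then show ?case by (intro bexI[of _ "us @ vs"]) (auto simp: word_prod_append_simple)
  qed
qed

section \<open>Simple length and right descents\<close>

lemma simple_length_word_le:
  assumes "ws \<in> lists S"
  shows "simple_length (word_prod ws) \<le> length ws"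
  unfolding simple_length_def using assms by (intro Least_le) auto

lemma ex_reduced_word:
  assumes "w \<in> carrier W"
  shows "\<exists>ws \<in> lists S. length ws = simple_length w \<and> w = word_prod ws"
proof -
  obtain ws where "ws \<in> lists S" "w = word_prod ws" using ex_word[OF assms] by blast
  then have "\<exists>k. \<exists>ws \<in> lists S. length ws = k \<and> w = word_prod ws" by blast
  then show ?thesis unfolding simple_length_def by (rule LeastI_ex)
qed

lemma simple_length_mult:
  assumes "x \<in> carrier W" "y \<in> carrier W"
  shows "simple_length (x \<otimes> y) \<le> simple_length x + simple_length y"
proof -
  obtain us vs where "us \<in> lists S" "length us = simple_length x" "x = word_prod us"
    "vs \<in> lists S" "length vs = simple_length y" "y = word_prod vs"
    using ex_reduced_word assms by metis
  then show ?thesis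
    using simple_length_word_le[of "us @ vs"] by (simp add: word_prod_append_simple)
qed

lemma simple_length_mult_word:
  assumes "x \<in> carrier W" "ws \<in> lists S"
  shows "simple_length (x \<otimes> word_prod ws) \<le> simple_length x + length ws"
  using simple_length_mult[of x "word_prod ws"] simple_length_word_le[of ws] assms by simp

text \<open>The last letter of a reduced word cancels.\<close>

lemma ex_right_descent:
  assumes "w \<in> carrier W" "w \<noteq> \<one>"
  shows "\<exists>t\<in>S. simple_length (w \<otimes> t) < simple_length w"
proof -
  obtain ws where ws: "ws \<in> lists S" "length ws = simple_length w" "w = word_prod ws"
    using ex_reduced_word assms by blast
  with assms have "ws \<noteq> []" by auto
  then obtain us t where us: "ws = us @ [t]" by (metis rev_exhaust)
  then have S: "us \<in> lists S" "t \<in> S" using ws by auto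
  then have "w \<otimes> t = word_prod us"
    using ws us by (simp add: word_prod_append_simple m_assoc simple_closed simple_square)
  then show ?thesis using simple_length_word_le[OF S(1)] ws us S by (intro bexI[of _ t]) auto
qed

subsection \<open>The bilinear form\<close>

text \<open>The sums in \<open>bform\<close> run over supports, which change under addition and
  scaling; over common larger index sets, bilinearity can be checked term by term.\<close>

lemma bform_superset:
  assumes "finite A" "finite B" "Poly_Mapping.keys u \<subseteq> A" "Poly_Mapping.keys v \<subseteq> B"
  shows "bform u v = (\<Sum>s\<in>A. \<Sum>t\<in>B. Poly_Mapping.lookup u s * Poly_Mapping.lookup v t * form_coeff s t)"
proof -
  have "bform u v = (\<Sum>s\<in>Poly_Mapping.keys u. \<Sum>t\<in>B.
      Poly_Mapping.lookup u s * Poly_Mapping.lookup v t * form_coeff s t)"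
    unfolding bform_def
    using assms by (intro sum.cong sum.mono_neutral_left) (auto simp: in_keys_iff)
  also have "\<dots> = (\<Sum>s\<in>A. \<Sum>t\<in>B.
      Poly_Mapping.lookup u s * Poly_Mapping.lookup v t * form_coeff s t)"
    using assms by (intro sum.mono_neutral_left) (auto simp: in_keys_iff)
  finally show ?thesis .
qed

lemma bform_add_left: "bform (u + v) w = bform u w + bform v w"
proof -
  let ?A = "Poly_Mapping.keys u \<union> Poly_Mapping.keys v" and ?B = "Poly_Mapping.keys w"
  have "finite ?A" "finite ?B" "Poly_Mapping.keys (u + v) \<subseteq> ?A"
    using Poly_Mapping.keys_add[of u v] by auto
  then show ?thesis
    by (simp add: bform_superset[of ?A ?B] lookup_add sum.distrib[symmetric] algebra_simps)
qed

lemma bform_add_right: "bform w (u + v) = bform w u + bform w v"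
proof -
  let ?A = "Poly_Mapping.keys u \<union> Poly_Mapping.keys v" and ?B = "Poly_Mapping.keys w"
  have "finite ?A" "finite ?B" "Poly_Mapping.keys (u + v) \<subseteq> ?A"
    using Poly_Mapping.keys_add[of u v] by auto
  then show ?thesis
    by (simp add: bform_superset[of ?B ?A] lookup_add sum.distrib[symmetric] algebra_simps)
qed

lemma bform_smul_left: "bform (smul c u) w = c * bform u w"
  using keys_smul_subset[of c u]
  by (simp add: bform_superset[of "Poly_Mapping.keys u" "Poly_Mapping.keys w"]
      sum_distrib_left mult.assoc)

lemma bform_smul_right: "bform w (smul c u) = c * bform w u"
  using keys_smul_subset[of c u]
  by (simp add: bform_superset[of "Poly_Mapping.keys w" "Poly_Mapping.keys u"]
      sum_distrib_left ac_simps)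

lemma bform_simple_root: "bform (simple_root s) (simple_root t) = form_coeff s t"
  by (simp add: bform_def simple_root_def lookup_single)

lemma form_coeff_diag: "s \<in> S \<Longrightarrow> form_coeff s s = 1"
  by (simp add: form_coeff_def m_diag)

lemma form_coeff_sym: "s \<in> S \<Longrightarrow> t \<in> S \<Longrightarrow> form_coeff s t = form_coeff t s"
  by (simp add: form_coeff_def m_sym)

text \<open>The matrix \<open>m\<close> is unconstrained outside \<open>S\<close>, so the form is symmetric only on vectors
  supported in \<open>S\<close>.\<close>

lemma bform_sym:
  assumes "Poly_Mapping.keys u \<subseteq> S" "Poly_Mapping.keys v \<subseteq> S"
  shows "bform u v = bform v u"
  unfolding bform_def
  by (subst sum.swap, intro sum.cong refl) (use assms form_coeff_sym in auto)

subsection \<open>The action\<close>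

lemma single_eq_smul: "Poly_Mapping.single s c = smul c (simple_root s)"
  by (simp add: simple_root_def smul_single)

lemma simple_act_eq: "simple_act s v = v + smul (- 2 * bform (simple_root s) v) (simple_root s)"
  by (rule poly_mapping_eqI)
    (simp add: simple_act_def single_eq_smul lookup_minus lookup_add)

lemma simple_act_add: "simple_act s (u + v) = simple_act s u + simple_act s v"
  by (rule poly_mapping_eqI) (simp add: simple_act_eq lookup_add bform_add_right algebra_simps)

lemma simple_act_smul: "simple_act s (smul c v) = smul c (simple_act s v)"
  by (rule poly_mapping_eqI) (simp add: simple_act_eq lookup_add bform_smul_right algebra_simps)

lemma simple_act_simple_act:
  assumes "s \<in> S"
  shows "simple_act s (simple_act s v) = v"
  by (rule poly_mapping_eqI)
    (simp add: simple_act_eq lookup_add bform_add_right bform_smul_right bform_simple_root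
      form_coeff_diag assms algebra_simps)

lemma simple_act_self: "s \<in> S \<Longrightarrow> simple_act s (simple_root s) = - simple_root s"
  by (rule poly_mapping_eqI) (simp add: simple_act_eq lookup_add bform_simple_root form_coeff_diag)

lemma keys_simple_act:
  assumes "s \<in> S" "Poly_Mapping.keys v \<subseteq> S"
  shows "Poly_Mapping.keys (simple_act s v) \<subseteq> S"
  using assms
  by (auto simp: in_keys_iff simple_act_def lookup_minus lookup_single when_def subset_iff split: if_splits)

text \<open>The root of \<open>s\<close> has norm 1, so the correction terms cancel once
  \<open>bform u (simple_root s)\<close> is symmetric.\<close>

lemma bform_simple_act:
  assumes "s \<in> S" "Poly_Mapping.keys u \<subseteq> S" "Poly_Mapping.keys v \<subseteq> S"
  shows "bform (simple_act s u) (simple_act s v) = bform u v"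
proof -
  have "Poly_Mapping.keys (simple_root s) \<subseteq> S" using assms by (simp add: simple_root_def)
  then have "bform u (simple_root s) = bform (simple_root s) u" using assms by (intro bform_sym)
  then show ?thesis
    by (simp add: simple_act_eq bform_add_left bform_add_right bform_smul_left bform_smul_right
        bform_simple_root form_coeff_diag assms algebra_simps)
qed

section \<open>Action of words and the dihedral relations\<close>

lemma foldr_act_add: "foldr simple_act ws (u + v) = foldr simple_act ws u + foldr simple_act ws v"
  by (induction ws) (simp_all add: simple_act_add)

lemma foldr_act_smul: "foldr simple_act ws (smul c v) = smul c (foldr simple_act ws v)"
  by (induction ws) (simp_all add: simple_act_smul)

lemma foldr_act_rev:
  "ws \<in> lists S \<Longrightarrow> foldr simple_act ws (foldr simple_act (rev ws) v) = v"
proof (induction ws arbitrary: v)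
  case (Cons s ws)
  then show ?case by (simp add: simple_act_simple_act)
qed simp

text \<open>Each further letter changes only its own coefficient, from U k to 2c U (k + 1) - U k
  with c = \<open>- form_coeff s t\<close>, which is the Chebyshev recursion.\<close>

lemma foldr_act_alt:
  assumes "s \<in> S" "t \<in> S"
  defines "U \<equiv> cheb (- form_coeff s t)"
  shows "foldr simple_act (alt k s t) (simple_root s) =
    (if even k then smul (U (Suc k)) (simple_root s) + smul (U k) (simple_root t)
     else smul (U k) (simple_root s) + smul (U (Suc k)) (simple_root t))"
proof (induction k)
  case 0
  show ?case by (rule poly_mapping_eqI) (simp add: lookup_add U_def)
next
  case (Suc k)
  then show ?case
    by (intro poly_mapping_eqI)
      (simp add: simple_act_eq lookup_add bform_add_right bform_smul_right bform_simple_root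
        form_coeff_diag form_coeff_sym[OF assms(2,1)] assms(1,2) U_def algebra_simps)
qed

text \<open>The matrix of the form on the span of the two simple roots has determinant
  \<open>1 - cos\<^sup>2 (\<pi> / m s t) \<noteq> 0\<close>, so every vector is the sum of a vector in that span, which is
  fixed by periodicity of the sine, and of a vector orthogonal to it, which is fixed trivially.\<close>

lemma foldr_act_relation:
  assumes st: "s \<in> S" "t \<in> S" "m s t \<noteq> 0"
  shows "foldr simple_act (concat (replicate (m s t) [s, t])) v = v"
proof (cases "s = t")
  case True
  then show ?thesis using st by (simp add: m_diag simple_act_simple_act)
next
  case False
  define n where "n = m s t"
  define c where "c = cos (pi / real n)"
  have n2: "2 \<le> n" using m_ge_2[OF st(1,2) False st(3)] by (simp add: n_def)
  have fc: "form_coeff s t = - c" "form_coeff t s = - c"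
    using st n2 by (simp_all add: form_coeff_def c_def n_def form_coeff_sym m_sym[of t s])
  define R where "R s t = foldr simple_act (concat (replicate n [s, t]))" for s t
  have fix_first: "R x y (simple_root x) = simple_root x"
    if "x \<in> S" "y \<in> S" "form_coeff x y = - c" for x y
    using foldr_act_alt[OF that(1,2), of "2 * n"] cheb_cos_pi_period[OF n2] that
    by (simp add: R_def alt_double c_def del: cheb.simps)
      (rule poly_mapping_eqI, simp add: lookup_add)
  \<comment> \<open>\<open>fix_first\<close> controls only the root of the first letter. For the
    root of \<open>t\<close> it applies to \<open>R t s\<close>, whose inverse is
    \<open>R s t\<close>.\<close>
  have rev: "rev (concat (replicate n [s, t])) = concat (replicate n [t, s])"
    by (simp add: rev_concat)
  have "R s t (R t s v) = v" for v
    using foldr_act_rev[of "concat (replicate n [s, t])" v] st rev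
    by (simp add: R_def in_lists_conv_set)
  with fix_first[of t s] have fix_t: "R s t (simple_root t) = simple_root t"
    using st fc by metis
  have fix_s: "R s t (simple_root s) = simple_root s" using fix_first[of s t] st fc by simp
  have "0 < sin (pi / real n)"
    using n2 by (intro sin_gt_zero) (auto simp: field_simps)
  then have det: "1 - c * c \<noteq> 0"
    using sin_cos_squared_add3[of "pi / real n"] unfolding c_def by (smt (verit) mult_pos_pos)
  define a where "a = bform (simple_root s) v"
  define b where "b = bform (simple_root t) v"
  \<comment> \<open>Cramer's rule for p - cq = a, q - cp = b: these are the coordinates of the
    component of v in the span.\<close>
  define p where "p = (a + c * b) / (1 - c * c)"
  define q where "q = (b + c * a) / (1 - c * c)"
  have pq: "p - c * q = a" "q - c * p = b"
  proof -
    have "p - c * q = a * (1 - c * c) / (1 - c * c)" "q - c * p = b * (1 - c * c) / (1 - c * c)"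
      unfolding p_def q_def times_divide_eq_right diff_divide_distrib[symmetric]
      by (simp_all add: algebra_simps)
    then show "p - c * q = a" "q - c * p = b" using det by simp_all
  qed
  define u where "u = v + smul (- p) (simple_root s) + smul (- q) (simple_root t)"
  have v: "v = u + smul p (simple_root s) + smul q (simple_root t)"
    by (rule poly_mapping_eqI) (simp add: u_def lookup_add)
  have "bform (simple_root s) u = 0" "bform (simple_root t) u = 0"
    using pq st
    by (simp_all add: u_def bform_add_right bform_smul_right bform_simple_root form_coeff_diag
        fc a_def[symmetric] b_def[symmetric] algebra_simps)
  then have "simple_act s u = u" "simple_act t u = u"
    by (auto intro!: poly_mapping_eqI simp: simple_act_eq lookup_add)
  then have "foldr simple_act (concat (replicate k [s, t])) u = u" for k
    by (induction k) auto
  then have "R s t u = u" by (simp add: R_def)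
  with fix_s fix_t have "R s t v = v"
    by (subst (1 2) v) (simp add: R_def foldr_act_add foldr_act_smul)
  then show ?thesis by (simp add: R_def n_def)
qed

section \<open>From words to group elements\<close>

lemma foldr_act_equiv:
  assumes "equivclp (coxeter_step S m) us vs"
  shows "foldr simple_act us v = foldr simple_act vs v"
proof -
  have step: "foldr simple_act xs v = foldr simple_act ys v" if "coxeter_step S m xs ys" for xs ys
    using that by cases (simp add: foldr_act_relation)
  from assms show ?thesis
    by (induction rule: equivclp_induct) (auto dest: step)
qed

text \<open>The word chosen in \<open>act\<close> has the same product as \<open>ws\<close>, so
  \<open>presentation\<close> links the two by relations, and these act trivially.\<close>

lemma act_word_prod:
  assumes "ws \<in> lists S"
  shows "act (word_prod ws) v = foldr simple_act ws v"
proof -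
  let ?P = "\<lambda>us. us \<in> lists S \<and> word_prod ws = word_prod us"
  have "?P (SOME us. ?P us)" using assms by (intro someI[of ?P ws]) simp
  then have "equivclp (coxeter_step S m) (SOME us. ?P us) ws"
    using presentation[of "SOME us. ?P us" ws] assms by (simp add: word_prod_def)
  then show ?thesis unfolding act_def by (rule foldr_act_equiv)
qed

lemma act_simple: "s \<in> S \<Longrightarrow> act s v = simple_act s v"
  using act_word_prod[of "[s]" v] by (simp add: simple_closed)

lemma act_one [simp]: "act \<one> v = v"
  using act_word_prod[of "[]" v] by simp

lemma act_mult:
  assumes "x \<in> carrier W" "y \<in> carrier W"
  shows "act (x \<otimes> y) v = act x (act y v)"
proof -
  obtain us vs where "us \<in> lists S" "x = word_prod us" "vs \<in> lists S" "y = word_prod vs"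
    using ex_word assms by metis
  then show ?thesis using act_word_prod[of "us @ vs" v]
    by (simp add: word_prod_append_simple act_word_prod)
qed

lemma act_add: "x \<in> carrier W \<Longrightarrow> act x (u + v) = act x u + act x v"
  using ex_word[of x] act_word_prod foldr_act_add by metis

lemma act_smul: "x \<in> carrier W \<Longrightarrow> act x (smul c v) = smul c (act x v)"
  using ex_word[of x] act_word_prod foldr_act_smul by metis

lemma act_uminus: "x \<in> carrier W \<Longrightarrow> act x (- v) = - act x v"
  using act_smul[of x "-1" v] by (simp add: smul_uminus)

lemma act_inv_act: "x \<in> carrier W \<Longrightarrow> act (inv x) (act x v) = v"
  by (simp flip: act_mult)

lemma act_act_inv: "x \<in> carrier W \<Longrightarrow> act x (act (inv x) v) = v"
  by (simp flip: act_mult)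

lemma keys_act:
  assumes "x \<in> carrier W" "Poly_Mapping.keys v \<subseteq> S"
  shows "Poly_Mapping.keys (act x v) \<subseteq> S"
proof -
  obtain us where us: "us \<in> lists S" "x = word_prod us" using ex_word assms by metis
  have "Poly_Mapping.keys (foldr simple_act us v) \<subseteq> S"
    using us(1) assms(2) by (induction us) (auto dest: keys_simple_act)
  then show ?thesis using us by (simp add: act_word_prod)
qed

lemma bform_act:
  assumes "x \<in> carrier W" "Poly_Mapping.keys u \<subseteq> S" "Poly_Mapping.keys v \<subseteq> S"
  shows "bform (act x u) (act x v) = bform u v"
proof -
  obtain ws where ws: "ws \<in> lists S" "x = word_prod ws" using ex_word assms by metis
  from ws(1) have "bform (foldr simple_act ws u) (foldr simple_act ws v) = bform u v"
  proof (induction ws)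
    case (Cons s ws)
    then have "ws \<in> lists S" "s \<in> S" by auto
    then show ?case
      using Cons.IH bform_simple_act[of s "foldr simple_act ws u" "foldr simple_act ws v"]
        keys_act[of "word_prod ws"] assms
      by (simp add: act_word_prod)
  qed simp
  then show ?thesis using ws by (simp add: act_word_prod)
qed

subsection \<open>Faithfulness\<close>

lemma word_prod_alt_double:
  assumes "s \<in> S" "t \<in> S" "m s t \<noteq> 0"
  shows "word_prod (alt (2 * m s t) s t) = \<one>"
  using word_prod_relation[OF assms] by (simp add: alt_double)

text \<open>A reduced product of \<open>v\<close> with an alternating word that ends in \<open>t\<close> and has at least
  \<open>m s t\<close> letters can be rewritten to end in \<open>s\<close>.\<close>

lemma alt_suffix_descent:
  assumes st: "s \<in> S" "t \<in> S" "m s t \<noteq> 0" "m s t \<le> k" and v: "v \<in> carrier W"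
  shows "simple_length (v \<otimes> word_prod (alt k s t) \<otimes> s) < simple_length v + k"
proof -
  define n where "n = m s t"
  have n: "n = m t s" "0 < n" "n \<le> k" using st by (simp_all add: n_def m_sym)
  obtain p where p: "length p = k - n" "alt k s t = p @ alt n s t"
    using alt_add[of "k - n" n s t] n by auto
  \<comment> \<open>Cut the relator of length 2n after n - 1 letters. Its last n + 1 letters, which
    are the last n letters of the given word followed by s, then equal the inverse of q, a word of
    only n - 1 letters.\<close>
  obtain q where q: "length q = n - 1" "alt (2 * n) t s = q @ alt (Suc n) t s"
    using alt_add[of "n - 1" "Suc n" t s] n by (auto simp: mult_2)
  have pS: "p \<in> lists S" using alt_in_lists[OF st(1,2), of k] p by simp
  have qS: "q \<in> lists S" using alt_in_lists[OF st(2,1), of "2 * n"] q by simp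
  then have qS': "rev q \<in> lists S" by auto
  have aS: "alt i s t \<in> lists S" "alt i t s \<in> lists S" for i
    by (rule alt_in_lists[OF st(1,2)], rule alt_in_lists[OF st(2,1)])
  have "word_prod q \<otimes> word_prod (alt (Suc n) t s) = \<one>"
    using word_prod_alt_double[OF st(2,1)] n(1,2) q(2) word_prod_append_simple[OF qS aS(2)]
    by (metis not_less_zero)
  then have "word_prod (alt (Suc n) t s) = word_prod (rev q)"
    using qS aS by (metis inv_word_prod inv_equality inv_inv inv_closed word_prod_closed_simple)
  moreover have "word_prod (alt k s t) \<otimes> s = word_prod p \<otimes> word_prod (alt (Suc n) t s)"
  proof -
    have "word_prod (alt k s t) \<otimes> s = word_prod (alt k s t @ [s])"
      using aS st by (simp add: word_prod_append_simple simple_closed)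
    also have "alt k s t @ [s] = p @ alt (Suc n) t s"
      using p alt_snoc[of n s t] by simp
    finally show ?thesis using pS aS by (simp only: word_prod_append_simple)
  qed
  ultimately have "v \<otimes> word_prod (alt k s t) \<otimes> s = v \<otimes> word_prod (p @ rev q)"
    using v pS qS' aS st by (simp add: word_prod_append_simple m_assoc simple_closed)
  then show ?thesis
    using simple_length_mult_word[OF v, of "p @ rev q"] pS qS' p q n by simp
qed

text \<open>The coefficients are U k and U (k + 1). They equal k and k + 1 if the order is infinite;
  otherwise k + 1 \<le> \<open>m s t\<close> keeps both angles within [0, pi].\<close>

lemma nonneg_alt_root:
  assumes "s \<in> S" "t \<in> S" "s \<noteq> t" "m s t \<noteq> 0 \<longrightarrow> k < m s t"
  shows "\<exists>p q. 0 \<le> p \<and> 0 \<le> q \<and>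
    act (word_prod (alt k s t)) (simple_root s) = smul p (simple_root s) + smul q (simple_root t)"
proof -
  define U where "U = cheb (- form_coeff s t)"
  have "0 \<le> U k \<and> 0 \<le> U (Suc k)"
  proof (cases "m s t = 0")
    case True
    then show ?thesis by (simp add: U_def form_coeff_def cheb_one)
  next
    case False
    then show ?thesis using assms m_ge_2[OF assms(1-3)]
      by (simp add: U_def form_coeff_def cheb_cos_pi_nonneg)
  qed
  moreover have "act (word_prod (alt k s t)) (simple_root s) =
    (if even k then smul (U (Suc k)) (simple_root s) + smul (U k) (simple_root t)
     else smul (U k) (simple_root s) + smul (U (Suc k)) (simple_root t))"
    using foldr_act_alt[OF assms(1,2), of k] act_word_prod[OF alt_in_lists[OF assms(1,2)]]
    by (simp add: U_def)
  ultimately show ?thesis by auto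
qed

text \<open>Tits: split off from \<open>w\<close> the longest alternating word in \<open>s\<close> and a right descent \<open>t\<close>
  that is a reduced suffix. By maximality the remaining factor \<open>v\<close> has neither \<open>s\<close> nor \<open>t\<close> as a
  right descent, so that the induction hypothesis applies to both simple roots.\<close>

lemma nonneg_act_simple_root:
  assumes "w \<in> carrier W" "s \<in> S" "simple_length w \<le> simple_length (w \<otimes> s)"
  shows "nonneg (act w (simple_root s))"
  using assms
proof (induction "simple_length w" arbitrary: w s rule: less_induct)
  case less
  show ?case
  proof (cases "w = \<one>")
    case True
    then show ?thesis by (simp add: nonneg_def simple_root_def lookup_single when_def)
  next
    case False
    obtain t where t: "t \<in> S" "simple_length (w \<otimes> t) < simple_length w"
      using ex_right_descent less False by blast
    have s: "s \<in> S" and w: "w \<in> carrier W" and st: "s \<noteq> t" using less t by auto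
    have sc: "s \<in> carrier W" "t \<in> carrier W" using s t simple_closed by auto
    have aS: "alt i s t \<in> lists S" for i by (rule alt_in_lists[OF s t(1)])
    \<comment> \<open>Subadditivity gives the reverse inequality, so the condition says that lengths
      add up.\<close>
    define P where "P k \<longleftrightarrow> (\<exists>v\<in>carrier W. w = v \<otimes> word_prod (alt k s t) \<and>
      simple_length v + k \<le> simple_length w)" for k
    have "w = (w \<otimes> t) \<otimes> word_prod (alt 1 s t)"
      using w t sc by (simp add: m_assoc simple_square)
    then have P1: "P 1"
      unfolding P_def using t(2) w sc
      by (intro bexI[of _ "w \<otimes> t"] conjI) (assumption, linarith, rule m_closed)
    have bound: "k \<le> simple_length w" if "P k" for k using that by (auto simp: P_def)
    define K where "K = Greatest P"
    have PK: "P K" unfolding K_def using P1 bound by (rule GreatestI_nat)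
    have K_max: "k \<le> K" if "P k" for k
      unfolding K_def using that bound by (rule Greatest_le_nat)
    have "1 \<le> K" using K_max P1 by blast
    then obtain j where j: "K = Suc j" by (cases K) auto
    obtain v where v: "v \<in> carrier W" "w = v \<otimes> word_prod (alt K s t)"
      "simple_length v + K \<le> simple_length w"
      using PK by (auto simp: P_def)
    \<comment> \<open>x is the letter that would extend the alternating word on the left; y is its
      present first letter.\<close>
    define x where "x = (if even K then t else s)"
    define y where "y = (if even j then t else s)"
    have xy: "{s, t} = {x, y}" "x \<in> S" "y \<in> S" using s t j by (auto simp: x_def y_def)
    have cancel: "v = v \<otimes> z \<otimes> z" if "z \<in> S" for z
      using that v by (simp add: m_assoc simple_square simple_closed)
    have "simple_length v \<le> simple_length (v \<otimes> x)"
    proof (rule ccontr)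
      assume "\<not> ?thesis"
      moreover have "w = (v \<otimes> x) \<otimes> word_prod (alt (Suc K) s t)"
        using v(1) xy aS[of K] by (subst v(2), subst cancel[OF xy(2)])
          (simp add: x_def[symmetric] m_assoc simple_closed)
      ultimately have "P (Suc K)"
        unfolding P_def using v xy by (intro bexI[of _ "v \<otimes> x"]) (auto simp: simple_closed)
      then show False using K_max by fastforce
    qed
    \<comment> \<open>If y shortened v, moving it from the alternating word to v would write w with
      fewer than \<open>simple_length w\<close> letters.\<close>
    moreover have "simple_length v \<le> simple_length (v \<otimes> y)"
    proof (rule ccontr)
      assume "\<not> ?thesis"
      moreover have "w = (v \<otimes> y) \<otimes> word_prod (alt j s t)"
        using v xy aS[of j] by (simp add: j y_def[symmetric] m_assoc simple_closed)
      moreover have "simple_length ((v \<otimes> y) \<otimes> word_prod (alt j s t)) \<le> simple_length (v \<otimes> y) + j"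
        using simple_length_mult_word[of "v \<otimes> y" "alt j s t"] v xy aS by (simp add: simple_closed)
      ultimately show False using v(3) j by simp
    qed
    ultimately have "simple_length v \<le> simple_length (v \<otimes> s)"
      "simple_length v \<le> simple_length (v \<otimes> t)"
      using xy(1) by (auto simp: doubleton_eq_iff)
    moreover have "simple_length v < simple_length w" using v(3) j by simp
    ultimately have nn: "nonneg (act v (simple_root s))" "nonneg (act v (simple_root t))"
      using less.hyps v(1) s t by blast+
    \<comment> \<open>Otherwise \<open>alt_suffix_descent\<close> would make s a right descent of
      w.\<close>
    have "m s t \<noteq> 0 \<longrightarrow> K < m s t"
      using alt_suffix_descent[OF s t(1) _ _ v(1), of K] v(2,3) less.prems(3)
      by (metis leD leI order_trans)
    then obtain p q where "0 \<le> p" "0 \<le> q"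
      "act (word_prod (alt K s t)) (simple_root s) = smul p (simple_root s) + smul q (simple_root t)"
      using nonneg_alt_root[OF s t(1) st] by blast
    then show ?thesis
      using nn v aS by (simp add: act_mult act_add act_smul nonneg_def lookup_add)
  qed
qed

text \<open>A right descent s of x is not one of xs, so Tits' theorem makes the image of the root of
  s under xs nonnegative; but this image is minus that root.\<close>

lemma act_faithful:
  assumes "x \<in> carrier W" "\<And>s. s \<in> S \<Longrightarrow> act x (simple_root s) = simple_root s"
  shows "x = \<one>"
proof (rule ccontr)
  assume "x \<noteq> \<one>"
  then obtain s where s: "s \<in> S" "simple_length (x \<otimes> s) < simple_length x"
    using ex_right_descent assms by blast
  have sc: "s \<in> carrier W" using s simple_closed by auto
  have "nonneg (act (x \<otimes> s) (simple_root s))"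
    using s sc assms by (intro nonneg_act_simple_root) (auto simp: m_assoc simple_square)
  also have "act (x \<otimes> s) (simple_root s) = - simple_root s"
    using s sc assms by (simp add: act_mult act_simple simple_act_self act_uminus)
  finally show False
    by (auto simp: nonneg_def simple_root_def lookup_single dest: spec[of _ s])
qed

subsection \<open>Roots and reflections\<close>

lemma reflections_closed: "t \<in> reflections \<Longrightarrow> t \<in> carrier W"
  by (auto simp: reflections_def simple_closed)

lemma simple_in_reflections: "s \<in> S \<Longrightarrow> s \<in> reflections"
  unfolding reflections_def using simple_closed
  by (intro CollectI exI[of _ \<one>] exI[of _ s]) auto

lemma keys_simple_root: "s \<in> S \<Longrightarrow> Poly_Mapping.keys (simple_root s) \<subseteq> S"
  by (simp add: simple_root_def)

lemma keys_root: "\<beta> \<in> roots \<Longrightarrow> Poly_Mapping.keys \<beta> \<subseteq> S"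
  using keys_act keys_simple_root unfolding roots_def by blast

lemma root_norm: "\<beta> \<in> roots \<Longrightarrow> bform \<beta> \<beta> = 1"
  unfolding roots_def using bform_act keys_simple_root
  by (auto simp: bform_simple_root form_coeff_diag)

lemma root_nonzero: "\<beta> \<in> roots \<Longrightarrow> \<beta> \<noteq> 0"
  using root_norm[of \<beta>] by (auto simp: bform_def)

lemma simple_root_positive:
  assumes "s \<in> S"
  shows "simple_root s \<in> positive_roots"
proof -
  have "simple_root s \<in> roots"
    unfolding roots_def using assms by (intro CollectI exI[of _ \<one>] exI[of _ s]) auto
  then show ?thesis
    by (auto simp: positive_roots_def simple_root_def lookup_single when_def)
qed

text \<open>Invariance of the form turns a conjugated simple reflection into the orthogonal
  reflection in the image root.\<close>

lemma act_conjugate: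
  assumes "u \<in> carrier W" "r \<in> S" "Poly_Mapping.keys v \<subseteq> S"
  defines "\<gamma> \<equiv> act u (simple_root r)"
  shows "act (u \<otimes> r \<otimes> inv u) v = v + smul (- 2 * bform \<gamma> v) \<gamma>"
proof -
  let ?v = "act (inv u) v"
  have "bform (simple_root r) ?v = bform \<gamma> (act u ?v)"
    unfolding \<gamma>_def using assms keys_act keys_simple_root by (simp add: bform_act)
  then have "bform (simple_root r) ?v = bform \<gamma> v" using assms by (simp add: act_act_inv)
  then show ?thesis
    using assms
    by (simp add: act_mult simple_closed act_simple simple_act_eq act_add act_smul act_act_inv)
qed

lemma reflection_of_root:
  assumes "t \<in> reflections"
  shows "\<exists>\<gamma>\<in>roots. \<forall>v. Poly_Mapping.keys v \<subseteq> S \<longrightarrow> act t v = v + smul (- 2 * bform \<gamma> v) \<gamma>"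
  using assms act_conjugate unfolding reflections_def roots_def by blast

text \<open>If the reflection in \<gamma> negates \<beta>, then \<beta> = c \<gamma>, and c squared
  is 1 because both have norm 1. The sign cancels in the reflection formula, so t and t' act alike
  on simple roots and faithfulness applies.\<close>

lemma reflection_unique:
  assumes \<beta>: "\<beta> \<in> roots" and t: "t \<in> reflections" "act t \<beta> = - \<beta>"
    and t': "t' \<in> reflections" "act t' \<beta> = - \<beta>"
  shows "t = t'"
proof -
  have eq: "act x v = v + smul (- 2 * bform \<beta> v) \<beta>"
    if x: "x \<in> reflections" "act x \<beta> = - \<beta>" and v: "Poly_Mapping.keys v \<subseteq> S" for x v
  proof -
    obtain \<gamma> where \<gamma>: "\<gamma> \<in> roots"
      "\<And>v. Poly_Mapping.keys v \<subseteq> S \<Longrightarrow> act x v = v + smul (- 2 * bform \<gamma> v) \<gamma>"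
      using reflection_of_root[OF x(1)] by blast
    define c where "c = bform \<gamma> \<beta>"
    have "- \<beta> = \<beta> + smul (- 2 * c) \<gamma>"
      using \<gamma>(2)[OF keys_root[OF \<beta>]] x by (simp add: c_def)
    then have "- Poly_Mapping.lookup \<beta> s =
        Poly_Mapping.lookup \<beta> s - 2 * c * Poly_Mapping.lookup \<gamma> s" for s
      by (subst (asm) poly_mapping_eq_iff) (simp add: fun_eq_iff lookup_add)
    then have \<beta>_eq: "\<beta> = smul c \<gamma>"
      by (intro poly_mapping_eqI) (simp add: field_simps)
    then have "c * c = 1"
      using root_norm[OF \<beta>] root_norm[OF \<gamma>(1)] by (simp add: bform_smul_left bform_smul_right)
    then have "- 2 * bform \<gamma> v = - 2 * (c * bform \<gamma> v) * c" by algebra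
    then show ?thesis
      unfolding \<gamma>(2)[OF v] \<beta>_eq by (simp only: bform_smul_left smul_smul)
  qed
  have c: "t \<in> carrier W" "t' \<in> carrier W" using t t' reflections_closed by auto
  have "inv t' \<otimes> t = \<one>"
  proof (rule act_faithful)
    fix s assume "s \<in> S"
    then have "act t (simple_root s) = act t' (simple_root s)"
      using eq t t' keys_simple_root by metis
    then show "act (inv t' \<otimes> t) (simple_root s) = simple_root s"
      using c by (simp add: act_mult act_inv_act)
  qed (use c in simp)
  then show ?thesis using c by (metis inv_closed inv_equality inv_inv)
qed

lemma ex_root_reflection:
  assumes "\<beta> \<in> roots"
  shows "\<exists>t\<in>reflections. act t \<beta> = - \<beta>"
proof -
  obtain w s where ws: "w \<in> carrier W" "s \<in> S" "\<beta> = act w (simple_root s)"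
    using assms by (auto simp: roots_def)
  then have "act (w \<otimes> s \<otimes> inv w) \<beta> = - \<beta>"
    by (simp add: act_mult simple_closed act_inv_act act_simple simple_act_self act_uminus)
  then show ?thesis using ws unfolding reflections_def by blast
qed

lemma root_reflection_in_reflections:
  assumes "\<beta> \<in> roots"
  shows "root_reflection \<beta> \<in> reflections"
proof -
  have "\<exists>!t. t \<in> reflections \<and> act t \<beta> = - \<beta>"
    by (rule ex_ex1I) (use ex_root_reflection[OF assms] in blast, use reflection_unique[OF assms] in simp)
  from theI'[OF this] show ?thesis unfolding root_reflection_def by (rule conjunct1)
qed

lemma root_reflection_simple_root:
  assumes "s \<in> S"
  shows "root_reflection (simple_root s) = s"
  unfolding root_reflection_def
proof (rule the_equality)
  show s: "s \<in> reflections \<and> act s (simple_root s) = - simple_root s"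
    using assms by (simp add: simple_in_reflections act_simple simple_act_self)
  show "t = s" if "t \<in> reflections \<and> act t (simple_root s) = - simple_root s" for t
    using that s reflection_unique simple_root_positive[OF assms]
    by (auto simp: positive_roots_def)
qed

subsection \<open>Depth\<close>

text \<open>A word for a reflection negating \<beta> shows that the minimum ranges over a nonempty
  set.\<close>

lemma root_depth_attained:
  assumes "\<beta> \<in> positive_roots"
  shows "\<exists>ss \<in> lists S. length ss = root_depth \<beta> \<and>
    act (word_prod ss) \<beta> \<in> uminus ` positive_roots"
proof -
  obtain t where t: "t \<in> reflections" "act t \<beta> = - \<beta>"
    using ex_root_reflection assms by (auto simp: positive_roots_def)
  obtain ss where "ss \<in> lists S" "t = word_prod ss"
    using ex_word reflections_closed t by blast
  then have "\<exists>k. \<exists>ss \<in> lists S. length ss = k \<and> act (word_prod ss) \<beta> \<in> uminus ` positive_roots"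
    using t assms by blast
  then show ?thesis unfolding root_depth_def by (rule LeastI_ex)
qed

text \<open>Depth 0 would make \<beta> both nonnegative and nonpositive, hence zero.\<close>

lemma root_depth_pos:
  assumes "\<beta> \<in> positive_roots"
  shows "1 \<le> root_depth \<beta>"
proof (rule ccontr)
  assume "\<not> ?thesis"
  then have "root_depth \<beta> = 0" by simp
  then obtain \<gamma> where \<gamma>: "\<gamma> \<in> positive_roots" "\<beta> = - \<gamma>"
    using root_depth_attained[OF assms] by auto
  then have "Poly_Mapping.lookup \<gamma> s = 0" for s
    using assms by (auto simp: positive_roots_def intro: antisym)
  then have "\<gamma> = 0" by (intro poly_mapping_eqI) simp
  then show False using root_nonzero \<gamma>(1) by (auto simp: positive_roots_def)
qed

lemma root_depth_simple_root:
  assumes "s \<in> S"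
  shows "root_depth (simple_root s) = 1"
proof (rule antisym)
  have "act (word_prod [s]) (simple_root s) \<in> uminus ` positive_roots"
    using assms simple_root_positive by (simp add: simple_closed act_simple simple_act_self)
  then show "root_depth (simple_root s) \<le> 1"
    unfolding root_depth_def using assms
    by (intro Least_le bexI[of _ "[s]"]) auto
qed (use root_depth_pos simple_root_positive assms in blast)

text \<open>A simple reflection changes a single coordinate, so the remaining coordinates of \<open>\<beta>\<close> are
  both nonnegative and nonpositive.\<close>

lemma root_depth_eq_1_imp_simple:
  assumes \<beta>: "\<beta> \<in> positive_roots" and "root_depth \<beta> = 1"
  shows "\<exists>s\<in>S. \<beta> = simple_root s"
proof -
  obtain ss where "ss \<in> lists S" "length ss = 1" "act (word_prod ss) \<beta> \<in> uminus ` positive_roots"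
    using root_depth_attained assms by metis
  then obtain s where s: "s \<in> S" "act s \<beta> \<in> uminus ` positive_roots"
    by (cases ss) (auto simp: simple_closed)
  then obtain \<gamma> where \<gamma>: "\<gamma> \<in> positive_roots" "simple_act s \<beta> = - \<gamma>"
    by (auto simp: act_simple)
  have "Poly_Mapping.lookup \<beta> r = 0" if "r \<noteq> s" for r
  proof -
    have "Poly_Mapping.lookup \<beta> r = - Poly_Mapping.lookup \<gamma> r"
      using arg_cong[OF \<gamma>(2), of "\<lambda>v. Poly_Mapping.lookup v r"] that
      by (simp add: simple_act_def lookup_minus lookup_single)
    moreover have "0 \<le> Poly_Mapping.lookup \<beta> r" "0 \<le> Poly_Mapping.lookup \<gamma> r"
      using \<beta> \<gamma>(1) by (auto simp: positive_roots_def)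
    ultimately show ?thesis by linarith
  qed
  then have eq: "\<beta> = smul (Poly_Mapping.lookup \<beta> s) (simple_root s)"
    by (intro poly_mapping_eqI) (auto simp: simple_root_def lookup_single when_def)
  \<comment> \<open>A nonnegative multiple of a simple root that has norm 1 is that simple
    root.\<close>
  define c where "c = Poly_Mapping.lookup \<beta> s"
  have "0 \<le> c" using \<beta> by (simp add: c_def positive_roots_def)
  moreover have "c * c = 1"
    using root_norm[of \<beta>] \<beta> eq s unfolding c_def[symmetric]
    by (simp add: positive_roots_def bform_smul_left bform_smul_right bform_simple_root form_coeff_diag)
  ultimately have "c = 1" by (metis mult_1 power2_eq_1_iff power2_eq_square neg_0_le_iff_le not_one_le_zero)
  then show ?thesis using eq s unfolding c_def[symmetric] by auto
qed

text \<open>The simple roots along a reduced word give one factorization, which yields both the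
  existence of a minimum and the bound.\<close>

lemma ex_minimal_depth:
  assumes "w \<in> carrier W"
  shows "\<exists>\<beta>s \<in> lists positive_roots.
    w = word_prod (map root_reflection \<beta>s) \<and> depth w = (\<Sum>\<beta>\<leftarrow>\<beta>s. root_depth \<beta>)"
    and "depth w \<le> simple_length w"
proof -
  obtain ws where ws: "ws \<in> lists S" "length ws = simple_length w" "w = word_prod ws"
    using ex_reduced_word assms by blast
  let ?\<beta>s = "map simple_root ws"
  have "map root_reflection ?\<beta>s = ws" "map root_depth ?\<beta>s = map (\<lambda>_. 1) ws"
    using ws(1) by (induction ws) (auto simp: root_reflection_simple_root root_depth_simple_root)
  moreover have "?\<beta>s \<in> lists positive_roots"
    using ws(1) simple_root_positive by auto
  ultimately have wit: "?\<beta>s \<in> lists positive_roots" "w = word_prod (map root_reflection ?\<beta>s)"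
    "simple_length w = (\<Sum>\<beta>\<leftarrow>?\<beta>s. root_depth \<beta>)"
    using ws by (simp_all only: sum_list_triv) simp
  then show "depth w \<le> simple_length w"
    unfolding depth_def by (intro Least_le) blast
  have "\<exists>d. \<exists>\<beta>s \<in> lists positive_roots.
      w = word_prod (map root_reflection \<beta>s) \<and> d = (\<Sum>\<beta>\<leftarrow>\<beta>s. root_depth \<beta>)"
    using wit by blast
  then show "\<exists>\<beta>s \<in> lists positive_roots.
      w = word_prod (map root_reflection \<beta>s) \<and> depth w = (\<Sum>\<beta>\<leftarrow>\<beta>s. root_depth \<beta>)"
    unfolding depth_def by (rule LeastI_ex)
qed

section \<open>Comparison of depth, reflection length and simple length\<close>

lemma reflection_length_le:
  "ts \<in> lists reflections \<Longrightarrow> reflection_length (word_prod ts) \<le> length ts"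
  unfolding reflection_length_def by (intro Least_le) auto

lemma length_le_sum_root_depth:
  "\<beta>s \<in> lists positive_roots \<Longrightarrow> length \<beta>s \<le> (\<Sum>\<beta>\<leftarrow>\<beta>s. root_depth \<beta>)"
  by (induction \<beta>s) (auto dest: root_depth_pos)

text \<open>Summands that are at least 1 leave no slack.\<close>

lemma root_depth_eq_1_if_sum_le_length:
  "\<beta>s \<in> lists positive_roots \<Longrightarrow> (\<Sum>\<beta>\<leftarrow>\<beta>s. root_depth \<beta>) \<le> length \<beta>s \<Longrightarrow> \<beta> \<in> set \<beta>s
    \<Longrightarrow> root_depth \<beta> = 1"
proof (induction \<beta>s)
  case (Cons \<gamma> \<beta>s)
  then have "1 \<le> root_depth \<gamma>" "length \<beta>s \<le> (\<Sum>\<beta>\<leftarrow>\<beta>s. root_depth \<beta>)"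
    using root_depth_pos length_le_sum_root_depth by auto
  then have "root_depth \<gamma> = 1" "(\<Sum>\<beta>\<leftarrow>\<beta>s. root_depth \<beta>) \<le> length \<beta>s"
    using Cons.prems(2) by auto
  then show ?case using Cons by auto
qed simp

lemma reflection_length_le_length:
  assumes "\<beta>s \<in> lists positive_roots"
  shows "reflection_length (word_prod (map root_reflection \<beta>s)) \<le> length \<beta>s"
proof -
  have "map root_reflection \<beta>s \<in> lists reflections"
    using assms root_reflection_in_reflections by (auto simp: positive_roots_def)
  from reflection_length_le[OF this] show ?thesis by simp
qed

lemma depth_eq_reflection_length_iff:
  assumes w: "w \<in> carrier W"
  shows "depth w = reflection_length w \<longleftrightarrow> simple_length w = reflection_length w"
proof -
  obtain \<beta>s where \<beta>s: "\<beta>s \<in> lists positive_roots" "w = word_prod (map root_reflection \<beta>s)"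
    "depth w = (\<Sum>\<beta>\<leftarrow>\<beta>s. root_depth \<beta>)"
    using ex_minimal_depth(1)[OF w] by blast
  \<comment> \<open>Equality of the outer terms collapses the chain, which is the converse
    direction; equality of \<open>reflection_length w\<close> and \<open>depth w\<close> forces
    every root used to have depth 1.\<close>
  have le: "reflection_length w \<le> length \<beta>s" "length \<beta>s \<le> depth w" "depth w \<le> simple_length w"
    using reflection_length_le_length[OF \<beta>s(1)] length_le_sum_root_depth[OF \<beta>s(1)]
      ex_minimal_depth(2)[OF w] \<beta>s by simp_all
  show ?thesis
  proof
    assume eq: "depth w = reflection_length w"
    have "map root_reflection \<beta>s \<in> lists S"
    proof -
      have "root_reflection \<beta> \<in> S" if "\<beta> \<in> set \<beta>s" for \<beta>
      proof -
        have "root_depth \<beta> = 1"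
          using root_depth_eq_1_if_sum_le_length[OF \<beta>s(1) _ that] le eq \<beta>s(3) by simp
        moreover have "\<beta> \<in> positive_roots" using \<beta>s(1) that by auto
        ultimately show ?thesis
          using root_depth_eq_1_imp_simple root_reflection_simple_root by metis
      qed
      then show ?thesis by auto
    qed
    from simple_length_word_le[OF this] have "simple_length w \<le> length \<beta>s"
      using \<beta>s(2) by simp
    then show "simple_length w = reflection_length w" using le eq by simp
  next
    assume "simple_length w = reflection_length w"
    then show "depth w = reflection_length w" using le by simp
  qed
qed

end

theorem mainTheorem5:
  fixes W :: "('a, 'b) monoid_scheme" and S :: "'a set" and m :: "'a \<Rightarrow> 'a \<Rightarrow> nat" and w :: 'a
  assumes "coxeter_system W S m"
    and "w \<in> carrier W"
  shows "coxeter_system.depth W S m w = coxeter_system.reflection_length W S w \<longleftrightarrow>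
         coxeter_system.simple_length W S w = coxeter_system.reflection_length W S w"
  using coxeter_system.depth_eq_reflection_length_iff[OF assms] .

end
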